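(* Let $T\subset\mathbb{R}^2$ be a convex polygon with the notation of the context. Then the space $\chi(\mathcal{M}\Lambda^1(T))$ reproduces all functions in $\mathcal{P}_1^-\Lambda^1(T)$, i.e., $$\mathcal{P}_1^-\Lambda^1(T)\subseteq\chi(\mathcal{M}\Lambda^1(T)).$$
   Context: $T\subset\mathbb{R}^2$ is a (closed) convex polygon with vertices $\mathbf{v}_1,\dots,\mathbf{v}_n$. Generalized barycentric coordinates on $T$ are functions $\lambda_1,\dots,\lambda_n$ on $T$ that are non-negative on $T$ and satisfy $L(\mathbf{x})=\sum_{i=1}^n L(\mathbf{v}_i)\lambda_i(\mathbf{x})$ for every linear (affine) function $L$ and all $\mathbf{x}\in T$. Standing assumption: $\lambda_i(\mathbf{v}_j)=\delta_{ij}$, each $\lambda_i$ is linear on each edge of $T$, and $\lambda_i\in C^1(T)$ (up to the boundary). For a scalar function $\phi$, $\mathrm{curl}\,\phi=(-\partial_y\phi,\partial_x\phi)^t$. Let $\mathbf{x}_*$ be an arbitrary fixed point in the interior of $T$. Define $$\chi(\mathcal{M}\Lambda^1(T))=\mathrm{span}\{\mathrm{curl}\,\lambda_i,\ 1\le i\le n\}+\mathrm{span}\{\mathbf{x}-\mathbf{x}_*\},$$ and $\mathcal{P}_1^-\Lambda^1(T)=\{a\mathbf{x}+\mathbf{c}:\ a\in\mathbb{R},\ \mathbf{c}\in\mathbb{R}^2\}$ (the lowest-order Raviart-Thomas space), as spaces of vector fields on $T$. *)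

theory Defs
  imports "HOL-Analysis.Analysis" "HOL-Library.Function_Algebras"
begin

text \<open>
  The vertices are exactly the extreme points, listed without repetition; no particular (cyclic)
  ordering is imposed. Nonempty interior excludes degenerate polygons, so that \<open>n \<ge> 3\<close> is automatic.
\<close>

definition convex_polygon :: "(real^2) set \<Rightarrow> nat \<Rightarrow> (nat \<Rightarrow> real^2) \<Rightarrow> bool" where
  "convex_polygon T n v \<longleftrightarrow>
     polytope T \<and> interior T \<noteq> {} \<and>
     inj_on v {1..n} \<and> v ` {1..n} = {p. p extreme_point_of T}"

definition affine_function :: "(real^2 \<Rightarrow> real) \<Rightarrow> bool" where
  "affine_function L \<longleftrightarrow> (\<exists>l c. linear l \<and> L = (\<lambda>x. l x + c))"

definition generalized_barycentric ::
    "(real^2) set \<Rightarrow> nat \<Rightarrow> (nat \<Rightarrow> real^2) \<Rightarrow> (nat \<Rightarrow> real^2 \<Rightarrow> real) \<Rightarrow> bool" where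
  "generalized_barycentric T n v lam \<longleftrightarrow>
     (\<forall>i\<in>{1..n}. \<forall>x\<in>T. 0 \<le> lam i x) \<and>
     (\<forall>L. affine_function L \<longrightarrow> (\<forall>x\<in>T. L x = (\<Sum>i=1..n. L (v i) * lam i x)))"

text \<open>
  \<open>C\<^sup>1\<close> up to the boundary: differentiable relative to \<open>T\<close> at every point of \<open>T\<close>, with continuous
  gradient. If \<open>T\<close> is convex with nonempty interior, the relative derivative is unique even at boundary
  points, and this agrees with having first-order partial derivatives in the interior that extend
  continuously to \<open>T\<close>.
\<close>

definition C1_on :: "(real^2) set \<Rightarrow> (real^2 \<Rightarrow> real) \<Rightarrow> bool" where
  "C1_on T f \<longleftrightarrow>
     (\<exists>G :: real^2 \<Rightarrow> real^2. continuous_on T G \<and>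
        (\<forall>x\<in>T. (f has_derivative (\<lambda>h. G x \<bullet> h)) (at x within T)))"

definition admissible_coordinates ::
    "(real^2) set \<Rightarrow> nat \<Rightarrow> (nat \<Rightarrow> real^2) \<Rightarrow> (nat \<Rightarrow> real^2 \<Rightarrow> real) \<Rightarrow> bool" where
  "admissible_coordinates T n v lam \<longleftrightarrow>
     generalized_barycentric T n v lam \<and>
     (\<forall>i\<in>{1..n}. \<forall>j\<in>{1..n}. lam i (v j) = (if i = j then 1 else 0)) \<and>
     (\<forall>i\<in>{1..n}. \<forall>e. e edge_of T \<longrightarrow>
        (\<exists>L. affine_function L \<and> (\<forall>x\<in>e. lam i x = L x))) \<and>
     (\<forall>i\<in>{1..n}. C1_on T (lam i))"

text \<open>
  Partial derivatives are read off from the derivative relative to \<open>T\<close>: at a boundary point (a vertex,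
  say) the line through it in a coordinate direction may meet \<open>T\<close> only in that point.
\<close>

definition partial_deriv :: "(real^2) set \<Rightarrow> 2 \<Rightarrow> (real^2 \<Rightarrow> real) \<Rightarrow> real^2 \<Rightarrow> real" where
  "partial_deriv T k f x = frechet_derivative f (at x within T) (axis k 1)"

definition curl :: "(real^2) set \<Rightarrow> (real^2 \<Rightarrow> real) \<Rightarrow> real^2 \<Rightarrow> real^2" where
  "curl T f x = vector [- partial_deriv T 2 f x, partial_deriv T 1 f x]"

text \<open>
  A vector field on \<open>T\<close> is represented by its extension by zero to the whole plane, so that equality
  of fields on \<open>T\<close> is equality of functions and the pointwise operations give a vector space.
\<close>

definition field_on :: "(real^2) set \<Rightarrow> (real^2 \<Rightarrow> real^2) \<Rightarrow> real^2 \<Rightarrow> real^2" where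
  "field_on T F = (\<lambda>x. if x \<in> T then F x else 0)"

definition field_scale :: "real \<Rightarrow> (real^2 \<Rightarrow> real^2) \<Rightarrow> real^2 \<Rightarrow> real^2" where
  "field_scale c F = (\<lambda>x. c *\<^sub>R F x)"

interpretation vfield: vector_space field_scale
  by unfold_locales (simp_all add: field_scale_def fun_eq_iff algebra_simps)

text \<open>The sum of the two spans is the elementwise sum of sets.\<close>

definition chi_space ::
    "(real^2) set \<Rightarrow> nat \<Rightarrow> (nat \<Rightarrow> real^2 \<Rightarrow> real) \<Rightarrow> real^2 \<Rightarrow> (real^2 \<Rightarrow> real^2) set" where
  "chi_space T n lam xs =
     vfield.span ((\<lambda>i. field_on T (curl T (lam i))) ` {1..n}) +
     vfield.span {field_on T (\<lambda>x. x - xs)}"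

definition P1_minus :: "(real^2) set \<Rightarrow> (real^2 \<Rightarrow> real^2) set" where
  "P1_minus T = {field_on T (\<lambda>x. a *\<^sub>R x + c) | (a::real) (c::real^2). True}"

end

theory Submission
  imports Defs
begin

text \<open>
  Write \<open>a x + c = a (x - x\<^sub>*) + d\<close> with \<open>d = c + a x\<^sub>*\<close>. The constant field \<open>d\<close> is the curl of the
  linear function \<open>L x = d\<^sub>2 x\<^sub>1 - d\<^sub>1 x\<^sub>2\<close>, and differentiating \<open>L = (\<Sum>i. L (v\<^sub>i) \<lambda>\<^sub>i)\<close> exhibits it as a
  combination of the fields \<open>curl \<lambda>\<^sub>i\<close>. Up to the boundary this needs that the derivative relative
  to \<open>T\<close> is unique even at the vertices.
\<close>

text \<open>At a boundary point only directions pointing into \<open>S\<close> are accessible. On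
  the segment from \<open>x\<close> to any \<open>y\<close> in \<open>S\<close>, the one-sided
  derivative of \<open>f\<close> fixes the value at \<open>y - x\<close>. Differences of such
  directions, with \<open>y\<close> in a ball inside \<open>S\<close>, give every direction up to
  scaling, so linearity settles the rest.\<close>

lemma has_derivative_unique_convex:
  fixes f :: "'a::real_normed_vector \<Rightarrow> 'b::real_normed_vector"
  assumes S: "convex S" "interior S \<noteq> {}" "x \<in> S"
    and f': "(f has_derivative f') (at x within S)"
    and f'': "(f has_derivative f'') (at x within S)"
  shows "f' = f''"
proof -
  interpret l': bounded_linear f' using f' by (rule has_derivative_bounded_linear)
  interpret l'': bounded_linear f'' using f'' by (rule has_derivative_bounded_linear)
  have along: "f' (y - x) = f'' (y - x)" if "y \<in> S" for y
  proof -
    let ?g = "\<lambda>t::real. x + t *\<^sub>R (y - x)"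
    have sub: "?g ` {0..1} \<subseteq> S"
    proof safe
      fix t :: real assume "t \<in> {0..1}"
      then have "(1 - t) *\<^sub>R x + t *\<^sub>R y \<in> S"
        using S that by (intro convexD) auto
      then show "?g t \<in> S" by (simp add: algebra_simps)
    qed
    have g: "(?g has_derivative (\<lambda>t. t *\<^sub>R (y - x))) (at 0 within {0..1})"
      by (auto intro!: derivative_eq_intros)
    \<comment> \<open>Stated for an arbitrary derivative \<open>F\<close>, so that it serves both
      \<open>f'\<close> and \<open>f''\<close>.\<close>
    have D: "((\<lambda>t. f (?g t)) has_vector_derivative F (y - x)) (at 0 within {0..1})"
      if "(f has_derivative F) (at x within S)" for F
    proof -
      interpret F: bounded_linear F using that by (rule has_derivative_bounded_linear)
      have "(f has_derivative F) (at (?g 0) within ?g ` {0..1})"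
        using has_derivative_subset[OF that sub] by simp
      from has_derivative_in_compose[OF g this] show ?thesis
        by (simp add: has_vector_derivative_def F.scaleR)
    qed
    show ?thesis
      by (rule vector_derivative_unique_within[OF _ D[OF f'] D[OF f'']])
        (simp add: trivial_limit_within islimpt_Icc)
  qed
  obtain z e where e: "e > 0" "ball z e \<subseteq> S"
    using S(2) mem_interior by blast
  have "f' h = f'' h" for h
  proof -
    obtain m where m: "norm h < m" "m > 0"
      by (meson gt_ex norm_ge_zero le_less_trans)
    \<comment> \<open>This scaling keeps \<open>z + s *\<^sub>R h\<close> in the ball around
      \<open>z\<close>. Dividing by \<open>m > norm h\<close> rather than by \<open>norm h\<close>
      also covers \<open>h = 0\<close>.\<close>
    define s where "s = e / m"
    have s: "s > 0" using e m by (simp add: s_def)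
    have "s * norm h < e" using e m by (simp add: s_def field_simps)
    then have "z + s *\<^sub>R h \<in> S" "z \<in> S"
      using e s by (auto simp: dist_norm subset_iff)
    from along[OF this(1)] along[OF this(2)]
    have "f' (z + s *\<^sub>R h - x) - f' (z - x) = f'' (z + s *\<^sub>R h - x) - f'' (z - x)" by simp
    then have "s *\<^sub>R f' h = s *\<^sub>R f'' h"
      by (simp add: l'.add l'.diff l'.scaleR l''.add l''.diff l''.scaleR)
    with s show ?thesis by simp
  qed
  then show ?thesis by (rule ext)
qed

lemma constant_field_sum_curl:
  assumes T: "convex_polygon T n v" and lam: "admissible_coordinates T n v lam" and x: "x \<in> T"
  shows "(\<Sum>i=1..n. (d$2 * v i$1 - d$1 * v i$2) *\<^sub>R curl T (lam i) x) = d"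
proof -
  let ?L = "\<lambda>y::real^2. d$2 * y$1 - d$1 * y$2"
  have conv: "convex T" "interior T \<noteq> {}"
    using T by (auto simp: convex_polygon_def polytope_imp_convex)
  have bl: "bounded_linear ?L"
    by (intro bounded_linear_sub bounded_linear_const_mult bounded_linear_vec_nth)
  then have "affine_function ?L"
    unfolding affine_function_def
    by (intro exI[of _ ?L] exI[of _ 0]) (auto simp: bounded_linear.linear)
  then have rep: "?L y = (\<Sum>i=1..n. ?L (v i) * lam i y)" if "y \<in> T" for y
    using lam that unfolding admissible_coordinates_def generalized_barycentric_def by blast
  let ?D = "\<lambda>i. frechet_derivative (lam i) (at x within T)"
  have lam': "(lam i has_derivative ?D i) (at x within T)" if "i \<in> {1..n}" for i
  proof -
    have "lam i differentiable (at x within T)"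
      using lam that x unfolding admissible_coordinates_def C1_on_def differentiable_def by blast
    then show ?thesis by (simp add: frechet_derivative_works)
  qed
  have "((\<lambda>y. \<Sum>i=1..n. ?L (v i) * lam i y) has_derivative (\<lambda>h. \<Sum>i=1..n. ?L (v i) * ?D i h))
      (at x within T)"
    by (intro has_derivative_sum has_derivative_mult_right lam')
  \<comment> \<open>The identity \<open>rep\<close> holds only on \<open>T\<close>, which suffices
    for a derivative relative to \<open>T\<close> at a point of \<open>T\<close>.\<close>
  then have "(?L has_derivative (\<lambda>h. \<Sum>i=1..n. ?L (v i) * ?D i h)) (at x within T)"
    by (rule has_derivative_transform[OF x, rotated]) (rule rep)
  from has_derivative_unique_convex[OF conv x bounded_linear_imp_has_derivative[OF bl] this]
  have "?L h = (\<Sum>i=1..n. ?L (v i) * ?D i h)" for h by (rule fun_cong)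
  \<comment> \<open>The first direction gives \<open>d$2\<close>, the second gives
    \<open>- d$1\<close>; the sign and the swap of components in \<open>curl\<close> turn these into
    \<open>d\<close>.\<close>
  from this[of "axis 1 1"] this[of "axis 2 1"] show ?thesis
    by (simp add: vec_eq_iff forall_2 sum_component curl_def partial_deriv_def axis_def
        sum_negf)
qed

theorem lemma3p4:
  fixes T :: "(real^2) set" and n :: nat
    and v :: "nat \<Rightarrow> real^2" and lam :: "nat \<Rightarrow> real^2 \<Rightarrow> real"
    and xs :: "real^2"
  assumes "convex_polygon T n v"
    and "admissible_coordinates T n v lam"
    and "xs \<in> interior T"
  shows "P1_minus T \<subseteq> chi_space T n lam xs"
proof
  fix F assume "F \<in> P1_minus T"
  then obtain a c where F: "F = field_on T (\<lambda>x. a *\<^sub>R x + c)"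
    by (auto simp: P1_minus_def)
  define d where "d = c + a *\<^sub>R xs"
  define A where "A = (\<Sum>i=1..n. field_scale (d$2 * v i$1 - d$1 * v i$2) (field_on T (curl T (lam i))))"
  define B where "B = field_scale a (field_on T (\<lambda>x. x - xs))"
  have "A \<in> vfield.span ((\<lambda>i. field_on T (curl T (lam i))) ` {1..n})"
    unfolding A_def by (intro vfield.span_sum vfield.span_scale vfield.span_base imageI)
  moreover have "B \<in> vfield.span {field_on T (\<lambda>x. x - xs)}"
    unfolding B_def by (intro vfield.span_scale vfield.span_base) simp
  moreover have "F = A + B"
  proof
    fix x
    have sum_at: "sum g I x = (\<Sum>i\<in>I. g i x)" for g :: "nat \<Rightarrow> real^2 \<Rightarrow> real^2" and I
      by (induction I rule: infinite_finite_induct) auto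
    \<comment> \<open>Off \<open>T\<close> both sides vanish because fields are extended by
      zero.\<close>
    have "A x = field_on T (\<lambda>_. d) x"
      using constant_field_sum_curl[OF assms(1,2), of x d]
      by (auto simp: A_def sum_at field_scale_def field_on_def)
    then show "F x = (A + B) x"
      by (simp add: F B_def d_def field_scale_def field_on_def algebra_simps)
  qed
  ultimately show "F \<in> chi_space T n lam xs"
    unfolding chi_space_def by (blast intro: set_plus_intro)
qed

end
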